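(* Let $a>0$, $b>0$ and let $X\sim\mathrm{BE}(a,b)$ be a beta-exponential random variable with parameters $a$ and $b$. Then $$\sqrt{\mathrm{Var}[X]}>\mathbb{E}[X]\ \text{ if } 0<a<1,\qquad \sqrt{\mathrm{Var}[X]}<\mathbb{E}[X]\ \text{ if } a>1,\qquad \sqrt{\mathrm{Var}[X]}=\mathbb{E}[X]\ \text{ if } a=1.$$
   Context: A random variable $X$ has the beta-exponential distribution $\mathrm{BE}(a,b)$, $a,b>0$, if $X=-\ln(1-V)$ where $V$ is a beta random variable with parameters $a$ and $b$; equivalently, $X$ has density $g(x;a,b)=\frac{1}{B(a,b)}(1-\mathrm{e}^{-x})^{a-1}\mathrm{e}^{-bx}\mathbf{1}_{(0,+\infty)}(x)$, where $B(a,b)=\int_0^{+\infty}(1-\mathrm{e}^{-x})^{a-1}\mathrm{e}^{-bx}\,\mathrm{d}x$ is the beta function. *)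

theory Defs
  imports "HOL-Probability.Probability"
begin

definition beta_density :: "real \<Rightarrow> real \<Rightarrow> real \<Rightarrow> real" where
  "beta_density a b v =
     (if 0 < v \<and> v < 1 then v powr (a - 1) * (1 - v) powr (b - 1) / Beta a b else 0)"

definition beta_exponential_density :: "real \<Rightarrow> real \<Rightarrow> real \<Rightarrow> real" where
  "beta_exponential_density a b x =
     (if 0 < x then (1 - exp (- x)) powr (a - 1) * exp (- b * x) / Beta a b else 0)"

lemma beta_density_measurable [measurable]: "beta_density a b \<in> borel_measurable borel"
  unfolding beta_density_def[abs_def] by measurable

lemma beta_exponential_density_measurable [measurable]:
  "beta_exponential_density a b \<in> borel_measurable borel"
  unfolding beta_exponential_density_def[abs_def] by measurable

lemma Beta_real_nonneg:
  fixes a b :: real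
  assumes "a > 0" "b > 0"
  shows "Beta a b \<ge> 0"
proof -
  have "Gamma a > 0" "Gamma b > 0" "Gamma (a + b) > 0"
    using assms by (auto intro: Gamma_real_pos)
  then show ?thesis by (simp add: Beta_def)
qed

lemma beta_density_nonneg: "a > 0 \<Longrightarrow> b > 0 \<Longrightarrow> beta_density a b v \<ge> 0"
  by (simp add: beta_density_def Beta_real_nonneg)

lemma beta_exponential_density_nonneg:
  "a > 0 \<Longrightarrow> b > 0 \<Longrightarrow> beta_exponential_density a b x \<ge> 0"
  by (simp add: beta_exponential_density_def Beta_real_nonneg)

lemma image_one_minus_exp:
  "(\<lambda>x::real. 1 - exp (- x)) ` (A \<inter> {0<..}) = {v. 0 < v \<and> v < 1 \<and> - ln (1 - v) \<in> A}"
proof safe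
  fix v :: real assume v: "0 < v" "v < 1" "- ln (1 - v) \<in> A"
  then have "v = 1 - exp (- (- ln (1 - v)))" "- ln (1 - v) \<in> A \<inter> {0<..}" by auto
  then show "v \<in> (\<lambda>x. 1 - exp (- x)) ` (A \<inter> {0<..})" by blast
qed auto

lemma change_of_variables_one_minus_exp:
  fixes a b I :: real
  assumes A: "A \<in> sets borel"
    and f: "((\<lambda>v. v powr (a - 1) * (1 - v) powr (b - 1)) has_integral I)
              {v. 0 < v \<and> v < 1 \<and> - ln (1 - v) \<in> A}"
  shows "((\<lambda>x. (1 - exp (- x)) powr (a - 1) * exp (- b * x)) has_integral I) (A \<inter> {0<..})"
proof -
  let ?f = "\<lambda>v::real. v powr (a - 1) * (1 - v) powr (b - 1)"
  let ?g = "\<lambda>x::real. 1 - exp (- x)"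
  let ?S = "A \<inter> {0<..}"
  have F: "(?f has_integral I) (?g ` ?S)"
    using f unfolding image_one_minus_exp .
  then have "?f absolutely_integrable_on (?g ` ?S)"
    by (intro nonnegative_absolutely_integrable_1) (auto simp: integrable_on_def)
  then have "?f absolutely_integrable_on (?g ` ?S) \<and> integral (?g ` ?S) ?f = I"
    using F by (simp add: integral_unique)
  moreover have "(\<lambda>x. \<bar>exp (- x)\<bar> * ?f (?g x)) absolutely_integrable_on ?S \<and>
      integral ?S (\<lambda>x. \<bar>exp (- x)\<bar> * ?f (?g x)) = I
    \<longleftrightarrow> ?f absolutely_integrable_on (?g ` ?S) \<and> integral (?g ` ?S) ?f = I"
    by (rule has_absolute_integral_change_of_variables_1')
       (use A in \<open>auto intro!: derivative_eq_intros inj_onI\<close>)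
  ultimately have *: "(\<lambda>x. \<bar>exp (- x)\<bar> * ?f (?g x)) absolutely_integrable_on ?S \<and>
      integral ?S (\<lambda>x. \<bar>exp (- x)\<bar> * ?f (?g x)) = I" by blast
  have eq: "\<bar>exp (- x)\<bar> * ?f (?g x) = ?g x powr (a - 1) * exp (- b * x)" for x
    by (simp add: powr_def algebra_simps flip: exp_add)
  from * show ?thesis
    unfolding eq by (simp add: has_integral_integrable_integral absolutely_integrable_on_def)
qed

lemma Beta_eq_integral_exp:
  fixes a b :: real
  assumes "a > 0" "b > 0"
  shows "((\<lambda>x. (1 - exp (- x)) powr (a - 1) * exp (- b * x)) has_integral Beta a b) {0<..}"
proof -
  have "((\<lambda>v. v powr (a - 1) * (1 - v) powr (b - 1)) has_integral Beta a b) {0<..<1}"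
    using has_integral_Beta_real[OF assms] has_integral_Icc_iff_Ioo by blast
  also have "{0<..<1} = {v::real. 0 < v \<and> v < 1 \<and> - ln (1 - v) \<in> UNIV}" by auto
  finally show ?thesis
    using change_of_variables_one_minus_exp[of UNIV a b "Beta a b"] by simp
qed

lemma distr_beta_density:
  assumes ab: "a > 0" "b > 0"
  shows "distr (density lborel (beta_density a b)) lborel (\<lambda>v. - ln (1 - v)) =
         density lborel (beta_exponential_density a b)"
proof (rule measure_eqI)
  let ?f = "\<lambda>v::real. v powr (a - 1) * (1 - v) powr (b - 1)"
  let ?k = "\<lambda>x::real. (1 - exp (- x)) powr (a - 1) * exp (- b * x)"
  fix A assume "A \<in> sets (distr (density lborel (beta_density a b)) lborel (\<lambda>v. - ln (1 - v)))"
  then have A[measurable]: "A \<in> sets borel" by simp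
  let ?T = "{v::real. 0 < v \<and> v < 1 \<and> - ln (1 - v) \<in> A}"
  have T[measurable]: "?T \<in> sets borel" by measurable
  have [measurable]: "(\<lambda>v::real. - ln (1 - v)) -` A \<in> sets borel"
    by (rule measurable_sets_borel[OF _ A]) measurable
  have "?f integrable_on {0..1}"
    using has_integral_Beta_real[OF ab] by (auto simp: integrable_on_def)
  then have "?f absolutely_integrable_on {0..1}"
    by (intro nonnegative_absolutely_integrable_1) auto
  then have "?f absolutely_integrable_on ?T"
    by (rule set_integrable_subset) auto
  then obtain I where I: "(?f has_integral I) ?T"
    by (auto simp: absolutely_integrable_on_def integrable_on_def)
  have K: "(?k has_integral I) (A \<inter> {0<..})"
    by (rule change_of_variables_one_minus_exp[OF A I])
  have I1: "((\<lambda>v. ?f v / Beta a b) has_integral I / Beta a b) ?T"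
    using I by (rule has_integral_divide)
  have K1: "((\<lambda>x. ?k x / Beta a b) has_integral I / Beta a b) (A \<inter> {0<..})"
    using K by (rule has_integral_divide)
  have "emeasure (distr (density lborel (beta_density a b)) lborel (\<lambda>v. - ln (1 - v))) A
      = (\<integral>\<^sup>+v. ennreal (beta_density a b v) * indicator ((\<lambda>v. - ln (1 - v)) -` A) v \<partial>lborel)"
    by (subst emeasure_distr, simp, simp, subst emeasure_density) auto
  also have "\<dots> = (\<integral>\<^sup>+v. ennreal (indicator ?T v * (?f v / Beta a b)) \<partial>lborel)"
    by (intro nn_integral_cong) (auto simp: beta_density_def indicator_def)
  also have "\<dots> = ennreal (I / Beta a b)"
    using nn_integral_has_integral_lebesgue[OF _ I1] Beta_real_nonneg[OF ab]
    by (simp add: nn_integral_completion)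
  also have "\<dots> = (\<integral>\<^sup>+x. ennreal (indicator (A \<inter> {0<..}) x * (?k x / Beta a b)) \<partial>lborel)"
    using nn_integral_has_integral_lebesgue[OF _ K1] Beta_real_nonneg[OF ab]
    by (simp add: nn_integral_completion)
  also have "\<dots> = (\<integral>\<^sup>+x. ennreal (beta_exponential_density a b x) * indicator A x \<partial>lborel)"
    by (intro nn_integral_cong) (auto simp: beta_exponential_density_def indicator_def)
  also have "\<dots> = emeasure (density lborel (beta_exponential_density a b)) A"
    by (subst emeasure_density) auto
  finally show "emeasure (distr (density lborel (beta_density a b)) lborel (\<lambda>v. - ln (1 - v))) A
      = emeasure (density lborel (beta_exponential_density a b)) A" .
qed simp

theorem distributed_beta_exponential_iff:
  assumes ab: "a > 0" "b > 0"
  shows "distributed M lborel X (\<lambda>x. ennreal (beta_exponential_density a b x)) \<longleftrightarrow>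
         (\<exists>V. distributed M lborel V (\<lambda>v. ennreal (beta_density a b v)) \<and>
              (\<forall>\<omega>\<in>space M. X \<omega> = - ln (1 - V \<omega>)))"
proof safe
  assume D: "distributed M lborel X (\<lambda>x. ennreal (beta_exponential_density a b x))"
  let ?V = "\<lambda>\<omega>. 1 - exp (- X \<omega>)"
  have [measurable]: "X \<in> borel_measurable M"
    using D by (simp add: distributed_def)
  have "distr M lborel ?V = distr (distr M lborel X) lborel (\<lambda>x. 1 - exp (- x))"
    by (subst distr_distr) (auto simp: comp_def)
  also have "\<dots> = distr (density lborel (beta_density a b)) lborel
                    ((\<lambda>x. 1 - exp (- x)) \<circ> (\<lambda>v. - ln (1 - v)))"
    unfolding distributed_distr_eq_density[OF D] distr_beta_density[OF ab, symmetric]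
    by (subst distr_distr) auto
  also have "\<dots> = distr (density lborel (beta_density a b)) lborel (\<lambda>v. v)"
    by (rule distr_cong_AE)
       (auto simp: AE_density beta_density_def)
  also have "\<dots> = density lborel (beta_density a b)"
    by (intro distr_id2) auto
  finally have "distributed M lborel ?V (\<lambda>v. ennreal (beta_density a b v))"
    by (simp add: distributed_def)
  then show "\<exists>V. distributed M lborel V (\<lambda>v. ennreal (beta_density a b v)) \<and>
              (\<forall>\<omega>\<in>space M. X \<omega> = - ln (1 - V \<omega>))"
    by (intro exI[of _ ?V]) auto
next
  fix V assume D: "distributed M lborel V (\<lambda>v. ennreal (beta_density a b v))"
    and X: "\<forall>\<omega>\<in>space M. X \<omega> = - ln (1 - V \<omega>)"
  have [measurable]: "V \<in> borel_measurable M"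
    using D by (simp add: distributed_def)
  have "(\<lambda>\<omega>. - ln (1 - V \<omega>)) \<in> borel_measurable M" by measurable
  then have XM: "X \<in> borel_measurable M"
    using X by (simp cong: measurable_cong)
  have "distr M lborel X = distr M lborel (\<lambda>\<omega>. - ln (1 - V \<omega>))"
    using X by (intro distr_cong) auto
  also have "\<dots> = distr (distr M lborel V) lborel (\<lambda>v. - ln (1 - v))"
    by (subst distr_distr) (auto simp: comp_def)
  also have "\<dots> = density lborel (beta_exponential_density a b)"
    unfolding distributed_distr_eq_density[OF D] by (rule distr_beta_density[OF ab])
  finally show "distributed M lborel X (\<lambda>x. ennreal (beta_exponential_density a b x))"
    using XM by (simp add: distributed_def)
qed

end

theory Submission
  imports Defs "HOL-Real_Asymp.Real_Asymp"
begin

text \<open>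
  Let \<open>q x = x / (exp x - 1)\<close>. Integrating the derivatives of \<open>x g(x)\<close> and \<open>x\<^sup>2 g(x)\<close> over the
  half-line, where \<open>g\<close> is the density, gives
  \<open>b E X = 1 + (a - 1) E q(X)\<close> and \<open>b E X\<^sup>2 = 2 E X + (a - 1) E (X q(X))\<close>, hence
  \<open>b (E X\<^sup>2 - 2 (E X)\<^sup>2) = (a - 1) (E (X q(X)) - 2 E X E q(X))\<close>.
  Since \<open>q\<close> is positive and decreasing, \<open>X\<close> and \<open>q(X)\<close> are negatively correlated, so the last factor
  is at most \<open>- E X E q(X) < 0\<close>, and \<open>Var X - (E X)\<^sup>2\<close> has the sign of \<open>1 - a\<close>.
\<close>

section \<open>Integrability of the moments\<close>

lemma power_le_exp:
  fixes c x :: real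
  assumes "c > 0" "x \<ge> 0"
  shows "x ^ n \<le> (real (Suc n) / c) ^ n * exp (c * x)"
proof -
  \<comment> \<open>The bound is \<open>y \<le> exp y\<close> raised to the power \<open>n\<close>.
    Scaling by \<open>Suc n\<close> instead of \<open>n\<close> keeps the constant meaningful for
    \<open>n = 0\<close>.\<close>
  define y where "y = c * x / real (Suc n)"
  have y: "y \<ge> 0" using assms by (simp add: y_def)
  have "y \<le> exp y" using exp_ge_add_one_self[of y] by linarith
  then have "y ^ n \<le> exp y ^ n" using y by (rule power_mono)
  also have "\<dots> = exp (real n * y)" by (simp add: exp_of_nat_mult)
  also have "\<dots> \<le> exp (real (Suc n) * y)" using y by (simp add: mult_right_mono)
  also have "\<dots> = exp (c * x)" by (simp add: y_def del: of_nat_Suc)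
  finally have "y ^ n \<le> exp (c * x)" .
  then have "(real (Suc n) / c) ^ n * y ^ n \<le> (real (Suc n) / c) ^ n * exp (c * x)"
    using assms by (intro mult_left_mono) auto
  moreover have "real (Suc n) / c * y = x" using assms by (simp add: y_def del: of_nat_Suc)
  ultimately show ?thesis by (metis power_mult_distrib)
qed

lemma Beta_real_pos:
  fixes a b :: real
  assumes "a > 0" "b > 0"
  shows "Beta a b > 0"
  using assms by (simp add: Beta_def Gamma_real_pos)

lemma integrable_beta_exponential_density:
  assumes "a > 0" "b > 0"
  shows "integrable lborel (beta_exponential_density a b)"
proof -
  have "((\<lambda>x. (1 - exp (- x)) powr (a - 1) * exp (- b * x) / Beta a b)
      has_integral Beta a b / Beta a b) {0<..}"
    using Beta_eq_integral_exp[OF assms] by (rule has_integral_divide)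
  then have "(beta_exponential_density a b has_integral Beta a b / Beta a b) UNIV"
    by (subst (asm) has_integral_restrict_UNIV[symmetric])
       (simp add: beta_exponential_density_def[abs_def])
  then have "(\<integral>\<^sup>+x. ennreal (beta_exponential_density a b x) \<partial>lborel) = ennreal (Beta a b / Beta a b)"
    by (intro nn_integral_has_integral_lborel) (auto intro: beta_exponential_density_nonneg assms)
  then show ?thesis
    by (intro integrableI_nonneg) (auto intro: beta_exponential_density_nonneg assms)
qed

text \<open>Half of the exponential decay absorbs the power of \<open>x\<close>; what remains is a
  multiple of the density with \<open>b / 2\<close> in place of \<open>b\<close>.\<close>

lemma integrable_beta_exponential_moment:
  assumes ab: "a > 0" "b > 0"
  shows "integrable lborel (\<lambda>x. beta_exponential_density a b x * x ^ n)"
proof (rule Bochner_Integration.integrable_bound)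
  \<comment> \<open>The first factor is the constant of \<open>power_le_exp\<close> at
    \<open>c = b / 2\<close>; the second exchanges the normalising constants of the two
    densities.\<close>
  define C where "C = (real (Suc n) / (b / 2)) ^ n * (Beta a (b / 2) / Beta a b)"
  show "integrable lborel (\<lambda>x. C * beta_exponential_density a (b / 2) x)"
    using ab by (intro integrable_mult_right integrable_beta_exponential_density) auto
  show "(\<lambda>x. beta_exponential_density a b x * x ^ n) \<in> borel_measurable lborel"
    by measurable
  have "norm (beta_exponential_density a b x * x ^ n) \<le> norm (C * beta_exponential_density a (b / 2) x)" for x
  proof (cases "x > 0")
    case True
    have B: "Beta a b > 0" "Beta a (b / 2) > 0" using ab by (auto intro!: Beta_real_pos)
    have e: "exp (b / 2 * x) * exp (- b * x) = exp (- (b / 2) * x)"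
      by (simp flip: exp_add)
    have "norm (beta_exponential_density a b x * x ^ n) = beta_exponential_density a b x * x ^ n"
      using beta_exponential_density_nonneg[OF ab, of x] True by simp
    also have "\<dots> \<le> beta_exponential_density a b x * ((real (Suc n) / (b / 2)) ^ n * exp (b / 2 * x))"
      using ab True by (intro mult_left_mono power_le_exp beta_exponential_density_nonneg) auto
    also have "\<dots> = (1 - exp (- x)) powr (a - 1) / Beta a b * (real (Suc n) / (b / 2)) ^ n
        * (exp (b / 2 * x) * exp (- b * x))"
      using True by (simp add: beta_exponential_density_def)
    also have "\<dots> = C * beta_exponential_density a (b / 2) x"
      unfolding e using True B by (simp add: beta_exponential_density_def C_def)
    finally show ?thesis by simp
  qed (simp add: beta_exponential_density_def)
  then show "AE x in lborel. norm (beta_exponential_density a b x * x ^ n)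
      \<le> norm (C * beta_exponential_density a (b / 2) x)" by simp
qed

section \<open>The quotient coming from the logarithmic derivative of the density\<close>

text \<open>The generating function of the Bernoulli numbers; it is \<open>x\<close> times the
  derivative of \<open>ln (1 - exp (- x))\<close>. Its value at 0 is 0, not the limit 1, so the
  facts below about its size and monotonicity assume positive arguments.\<close>

definition bernoulli_quotient :: "real \<Rightarrow> real" where
  "bernoulli_quotient x = x / (exp x - 1)"

lemma bernoulli_quotient_measurable [measurable]: "bernoulli_quotient \<in> borel_measurable borel"
  unfolding bernoulli_quotient_def[abs_def] by measurable

lemma bernoulli_quotient_pos: "x > 0 \<Longrightarrow> bernoulli_quotient x > 0"
  by (simp add: bernoulli_quotient_def)

lemma bernoulli_quotient_le_1: "x > 0 \<Longrightarrow> bernoulli_quotient x \<le> 1"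
  using exp_ge_add_one_self[of x]
  by (simp add: bernoulli_quotient_def divide_le_eq del: exp_ge_add_one_self)

text \<open>By convexity of \<open>exp\<close>, the slope of the chord from 0 to \<open>x\<close>
  increases with \<open>x\<close>; the quotient is the reciprocal of that slope.\<close>

lemma bernoulli_quotient_antimono:
  assumes "0 < x" "x \<le> y"
  shows "bernoulli_quotient y \<le> bernoulli_quotient x"
proof -
  have "exp ((1 - x / y) *\<^sub>R 0 + (x / y) *\<^sub>R y) \<le> (1 - x / y) * exp 0 + x / y * exp y"
    using assms by (intro convex_onD[OF exp_convex]) auto
  then have "exp x - 1 \<le> x * (exp y - 1) / y"
    using assms by (simp add: algebra_simps diff_divide_distrib)
  then have "y * (exp x - 1) \<le> x * (exp y - 1)"
    using assms by (simp add: pos_le_divide_eq mult.commute)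
  then show ?thesis using assms by (simp add: bernoulli_quotient_def field_simps)
qed

lemma integrable_beta_exponential_moment_quotient:
  assumes ab: "a > 0" "b > 0"
  shows "integrable lborel (\<lambda>x. beta_exponential_density a b x * (x ^ n * bernoulli_quotient x))"
proof (rule Bochner_Integration.integrable_bound)
  show "integrable lborel (\<lambda>x. beta_exponential_density a b x * x ^ n)"
    by (rule integrable_beta_exponential_moment[OF ab])
  have "\<bar>beta_exponential_density a b x * (x ^ n * bernoulli_quotient x)\<bar>
      \<le> \<bar>beta_exponential_density a b x * x ^ n\<bar>" for x
  proof (cases "x > 0")
    case True
    then have "\<bar>bernoulli_quotient x\<bar> \<le> 1"
      using bernoulli_quotient_pos[of x] bernoulli_quotient_le_1[of x] by simp
    then show ?thesis
      using mult_left_mono[of "\<bar>bernoulli_quotient x\<bar>" 1 "\<bar>beta_exponential_density a b x * x ^ n\<bar>"]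
      by (simp add: abs_mult mult.assoc)
  qed (simp add: beta_exponential_density_def)
  then show "AE x in lborel. norm (beta_exponential_density a b x * (x ^ n * bernoulli_quotient x))
      \<le> norm (beta_exponential_density a b x * x ^ n)" by simp
qed measurable

section \<open>Moment recurrence by integrating a derivative\<close>

text \<open>The density itself may blow up at 0 when \<open>a < 1\<close>; the extra factor
  \<open>x\<close> makes the product behave like \<open>x powr a\<close>.\<close>

lemma beta_exponential_density_at_right_0:
  assumes ab: "a > 0" "b > 0"
  shows "((\<lambda>x. x * ((1 - exp (- x)) powr (a - 1) * exp (- b * x))) \<longlongrightarrow> 0) (at_right (0::real))"
  using assms by real_asymp

lemma beta_exponential_density_at_top:
  assumes ab: "a > 0" "b > 0"
  shows "((\<lambda>x. x ^ n * ((1 - exp (- x)) powr (a - 1) * exp (- b * x))) \<longlongrightarrow> 0) (at_top :: real filter)"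
  using assms by real_asymp

text \<open>The density has logarithmic derivative \<open>(a - 1) / (exp x - 1) - b\<close> on the
  half-line, so the derivative of \<open>x ^ Suc n * g x\<close> splits into the three integrands,
  and its integral vanishes with the boundary terms.\<close>

lemma beta_exponential_moment_recurrence:
  assumes ab: "a > 0" "b > 0"
  defines "g \<equiv> beta_exponential_density a b"
  shows "b * (\<integral>x. g x * x ^ Suc n \<partial>lborel) = real (Suc n) * (\<integral>x. g x * x ^ n \<partial>lborel)
    + (a - 1) * (\<integral>x. g x * (x ^ n * bernoulli_quotient x) \<partial>lborel)"
proof -
  define w where "w x = (1 - exp (- x)) powr (a - 1) * exp (- b * x) / Beta a b" for x
  define F where "F x = x ^ Suc n * w x" for x
  define f where "f x = w x * (real (Suc n) * x ^ n + (a - 1) * (x ^ n * bernoulli_quotient x)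
    - b * x ^ Suc n)" for x
  \<comment> \<open>\<open>h\<close> is \<open>f\<close> cut off to the half-line: \<open>f\<close>
    enters the fundamental theorem of calculus, while \<open>h\<close> is a combination of functions
    already known to be integrable.\<close>
  define h where "h x = real (Suc n) * (g x * x ^ n) + (a - 1) * (g x * (x ^ n * bernoulli_quotient x))
    - b * (g x * x ^ Suc n)" for x
  have gw: "g x = (if 0 < x then w x else 0)" for x
    by (simp add: g_def w_def beta_exponential_density_def)
  have hf: "h x = indicator {0<..} x *\<^sub>R f x" for x
    by (simp add: h_def f_def gw algebra_simps)
  note int = integrable_beta_exponential_moment[OF ab, folded g_def]
    integrable_beta_exponential_moment_quotient[OF ab, folded g_def]
  have h: "integrable lborel h"
    unfolding h_def[abs_def] by (intro Bochner_Integration.integrable_diff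
      Bochner_Integration.integrable_add integrable_mult_right int)
  have E: "einterval 0 \<infinity> = {0<..}" by (auto simp: einterval_def)
  have "(LBINT x=0..\<infinity>. f x) = 0 - 0"
  proof (rule interval_integral_FTC_integrable[where F = F])
    fix x :: real assume "0 < ereal x" "ereal x < \<infinity>"
    then have x: "x > 0" by simp
    have d: "((\<lambda>x. (1 - exp (- x)) powr (a - 1)) has_real_derivative
        (1 - exp (- x)) powr (a - 1) * ((a - 1) / (exp x - 1))) (at x)"
    proof -
      have "exp x - 1 > 0" using x by simp
      \<comment> \<open>The power rule yields the exponent \<open>a - 2\<close>; these two
        identities restore \<open>a - 1\<close>, so that \<open>w\<close> factors out of its own
        derivative.\<close>
      have "1 - exp (- x) = (exp x - 1) * exp (- x)" by (simp add: algebra_simps flip: exp_add)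
      moreover have "(1 - exp (- x)) powr (a - 1) = (1 - exp (- x)) powr (a - 2) * (1 - exp (- x))"
        using x powr_add[of "1 - exp (- x)" "a - 2" 1] by simp
      ultimately have "(1 - exp (- x)) powr (a - 1) * ((a - 1) / (exp x - 1))
          = (a - 1) * (1 - exp (- x)) powr (a - 2) * exp (- x)"
        using \<open>exp x - 1 > 0\<close> by simp
      then show ?thesis
        using x by (auto intro!: derivative_eq_intros simp: algebra_simps)
    qed
    have e: "((\<lambda>x. exp (- b * x)) has_real_derivative exp (- b * x) * (- b)) (at x)"
      by (auto intro!: derivative_eq_intros)
    have "(w has_real_derivative w x * ((a - 1) / (exp x - 1) - b)) (at x)"
      unfolding w_def[abs_def]
      by (rule DERIV_cong[OF DERIV_cdivide[OF DERIV_mult[OF d e]]])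
         (simp add: algebra_simps diff_divide_distrib add_divide_distrib)
    then have "(F has_real_derivative real (Suc n) * x ^ n * w x
        + w x * ((a - 1) / (exp x - 1) - b) * x ^ Suc n) (at x)"
      unfolding F_def[abs_def] using DERIV_mult[OF DERIV_pow[of "Suc n" x]] by simp
    also have "real (Suc n) * x ^ n * w x + w x * ((a - 1) / (exp x - 1) - b) * x ^ Suc n = f x"
      by (simp add: f_def bernoulli_quotient_def algebra_simps diff_divide_distrib)
    finally show "(F has_vector_derivative f x) (at x)"
      by (simp add: has_real_derivative_iff_has_vector_derivative)
    show "isCont f x"
      unfolding f_def w_def bernoulli_quotient_def using x Beta_real_pos[OF ab]
      by (intro continuous_intros) auto
  next
    show "set_integrable lborel (einterval 0 \<infinity>) f"
      unfolding set_integrable_def E using h by (simp add: hf[abs_def])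
    \<comment> \<open>Only one factor \<open>x\<close> is needed to kill the singularity; the limit
      is 0 for every \<open>n\<close>, including \<open>n = 0\<close>, where
      \<open>0 ^ n = 1\<close>.\<close>
    have "((\<lambda>x. x ^ n * (x * ((1 - exp (- x)) powr (a - 1) * exp (- b * x))) / Beta a b)
        \<longlongrightarrow> 0 ^ n * 0 / Beta a b) (at_right 0)"
      using Beta_real_pos[OF ab]
      by (intro tendsto_intros beta_exponential_density_at_right_0 ab) auto
    then show "((F \<circ> real_of_ereal) \<longlongrightarrow> 0) (at_right 0)"
      unfolding zero_ereal_def ereal_tendsto_simps by (simp add: F_def[abs_def] w_def mult_ac)
    have "((\<lambda>x. x ^ Suc n * ((1 - exp (- x)) powr (a - 1) * exp (- b * x)) / Beta a b)
        \<longlongrightarrow> 0 / Beta a b) at_top"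
      using Beta_real_pos[OF ab]
      by (intro tendsto_intros beta_exponential_density_at_top ab) auto
    then show "((F \<circ> real_of_ereal) \<longlongrightarrow> 0) (at_left \<infinity>)"
      unfolding ereal_tendsto_simps by (simp add: F_def[abs_def] w_def mult_ac)
  qed simp
  then have "(\<integral>x. h x \<partial>lborel) = 0"
    by (simp add: interval_lebesgue_integral_def set_lebesgue_integral_def E hf)
  then show ?thesis
    unfolding h_def by (simp add: int del: power_Suc)
qed

section \<open>Comparison of standard deviation and mean\<close>

theorem corollary2:
  fixes M :: "'s measure" and X :: "'s \<Rightarrow> real" and a b :: real
  assumes "prob_space M"
    and "a > 0" and "b > 0"
    and "distributed M lborel X (\<lambda>x. ennreal (beta_exponential_density a b x))"
  shows "(a < 1 \<longrightarrow> sqrt (prob_space.variance M X) > prob_space.expectation M X) \<and>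
         (a > 1 \<longrightarrow> sqrt (prob_space.variance M X) < prob_space.expectation M X) \<and>
         (a = 1 \<longrightarrow> sqrt (prob_space.variance M X) = prob_space.expectation M X)"
proof -
  interpret prob_space M by fact
  note ab = \<open>a > 0\<close> \<open>b > 0\<close> and D = assms(4)
  define g where "g = beta_exponential_density a b"
  let ?q = bernoulli_quotient
  have gm [measurable]: "g \<in> borel_measurable borel" by (simp add: g_def)
  have g0: "g x \<ge> 0" for x using ab by (simp add: g_def beta_exponential_density_nonneg)
  have gE: "(\<integral>x. g x * f x \<partial>lborel) = expectation (\<lambda>\<omega>. f (X \<omega>))"
    if "f \<in> borel_measurable borel" for f :: "real \<Rightarrow> real"
    using distributed_integral[OF D, of f] that g0 by (simp add: g_def)
  have gI: "integrable M (\<lambda>\<omega>. f (X \<omega>))"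
    if "f \<in> borel_measurable borel" "integrable lborel (\<lambda>x. g x * f x)" for f :: "real \<Rightarrow> real"
    using distributed_integrable[OF D, of f] that g0 by (simp add: g_def)
  have mom: "integrable M (\<lambda>\<omega>. X \<omega> ^ n)" for n
    using gI[of "\<lambda>x. x ^ n"] integrable_beta_exponential_moment[OF ab] by (simp add: g_def)
  have momq: "integrable M (\<lambda>\<omega>. X \<omega> ^ n * ?q (X \<omega>))" for n
    using gI[of "\<lambda>x. x ^ n * ?q x"] integrable_beta_exponential_moment_quotient[OF ab]
    by (simp add: g_def)
  note int = mom[of 1, simplified] mom[of 2] momq[of 0, simplified] momq[of 1, simplified]
  have rec: "b * expectation (\<lambda>\<omega>. X \<omega> ^ Suc n) = real (Suc n) * expectation (\<lambda>\<omega>. X \<omega> ^ n)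
      + (a - 1) * expectation (\<lambda>\<omega>. X \<omega> ^ n * ?q (X \<omega>))" for n
    using beta_exponential_moment_recurrence[OF ab, of n, folded g_def]
    by (subst (asm) (1 2 3) gE) auto
  define \<mu> where "\<mu> = expectation X"
  define m2 where "m2 = expectation (\<lambda>\<omega>. X \<omega> ^ 2)"
  define k where "k = expectation (\<lambda>\<omega>. ?q (X \<omega>))"
  define l where "l = expectation (\<lambda>\<omega>. X \<omega> * ?q (X \<omega>))"
  have r1: "b * \<mu> = 1 + (a - 1) * k"
    using rec[of 0] by (simp add: \<mu>_def k_def prob_space)
  have r2: "b * m2 = 2 * \<mu> + (a - 1) * l"
    using rec[of 1] by (simp add: \<mu>_def l_def m2_def numeral_2_eq_2)
  \<comment> \<open>Positivity and monotonicity of the quotient are available only at positive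
    arguments.\<close>
  have X0: "AE \<omega> in M. X \<omega> > 0"
  proof -
    have "AE x in density lborel (\<lambda>x. ennreal (g x)). x > 0"
      by (auto simp: AE_density g_def beta_exponential_density_def)
    then have "AE x in distr M lborel X. x > 0"
      unfolding g_def distributed_distr_eq_density[OF D] .
    then show ?thesis using distributed_measurable[OF D] by (subst (asm) AE_distr_iff) auto
  qed
  have pos: "expectation f > 0" if "integrable M f" "AE \<omega> in M. f \<omega> > 0" for f :: "'s \<Rightarrow> real"
    using integral_less_AE_space[of "\<lambda>_. 0" f] that by (simp add: emeasure_space_1)
  have mu: "\<mu> > 0" unfolding \<mu>_def using int X0 by (intro pos) auto
  have k: "k > 0" unfolding k_def
    using int X0 by (intro pos) (auto elim!: eventually_mono simp: bernoulli_quotient_pos)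
  \<comment> \<open>Chebyshev's association inequality without an independent copy: both factors are
    centred at \<open>\<mu>\<close> and have opposite signs. As \<open>X - \<mu>\<close> has mean 0,
    the constant \<open>?q \<mu>\<close> drops out and the expectation is the covariance
    \<open>l - \<mu> * k\<close>.\<close>
  have "expectation (\<lambda>\<omega>. (X \<omega> - \<mu>) * (?q (X \<omega>) - ?q \<mu>)) \<le> expectation (\<lambda>_. 0)"
  proof (rule integral_mono_AE)
    show "integrable M (\<lambda>\<omega>. (X \<omega> - \<mu>) * (?q (X \<omega>) - ?q \<mu>))"
      using int by (simp add: algebra_simps)
    show "AE \<omega> in M. (X \<omega> - \<mu>) * (?q (X \<omega>) - ?q \<mu>) \<le> 0"
      using X0
    proof eventually_elim
      case (elim \<omega>)
      then show ?case
        using bernoulli_quotient_antimono[of "X \<omega>" \<mu>] bernoulli_quotient_antimono[of \<mu> "X \<omega>"] mu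
        by (cases "X \<omega> \<le> \<mu>") (auto simp: mult_le_0_iff)
    qed
  qed simp
  moreover have "expectation (\<lambda>\<omega>. (X \<omega> - \<mu>) * (?q (X \<omega>) - ?q \<mu>))
      = expectation (\<lambda>\<omega>. X \<omega> * ?q (X \<omega>) - ?q \<mu> * X \<omega> - \<mu> * ?q (X \<omega>) + \<mu> * ?q \<mu>)"
    by (simp add: algebra_simps)
  also have "\<dots> = l - \<mu> * k"
    using int by (simp add: prob_space \<mu>_def[symmetric] k_def[symmetric] l_def[symmetric])
  ultimately have "l \<le> \<mu> * k" by simp
  \<comment> \<open>Strictness comes from the second copy of \<open>\<mu> * k\<close>, not from the
    correlation inequality.\<close>
  moreover have "\<mu> * k > 0" using mu k by simp
  ultimately have neg: "l - 2 * \<mu> * k < 0" by linarith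
  have var: "variance X = m2 - \<mu>\<^sup>2"
    using int by (simp add: variance_eq \<mu>_def m2_def)
  have "b * (variance X - \<mu>\<^sup>2) = b * m2 - 2 * \<mu> * (b * \<mu>)"
    unfolding var by (simp add: algebra_simps power2_eq_square)
  \<comment> \<open>The term \<open>2 * \<mu>\<close> of \<open>r2\<close> cancels against
    \<open>2 * \<mu>\<close> times the 1 in \<open>r1\<close>, leaving only multiples of
    \<open>a - 1\<close>.\<close>
  also have "\<dots> = (a - 1) * (l - 2 * \<mu> * k)"
    unfolding r1 r2 by (simp add: algebra_simps)
  finally have eq: "b * (variance X - \<mu>\<^sup>2) = (a - 1) * (l - 2 * \<mu> * k)" .
  have "\<mu> < sqrt (variance X)" if "a < 1"
  proof -
    have "b * (variance X - \<mu>\<^sup>2) > 0" using eq neg that by (simp add: mult_neg_neg)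
    then show ?thesis using ab by (intro real_less_rsqrt) (simp add: zero_less_mult_iff)
  qed
  moreover have "sqrt (variance X) < \<mu>" if "a > 1"
  proof -
    have "b * (variance X - \<mu>\<^sup>2) < 0" using eq neg that by (simp add: mult_pos_neg)
    then have "variance X < \<mu>\<^sup>2" using ab by (simp add: mult_less_0_iff)
    then show ?thesis using mu real_sqrt_less_mono[of "variance X" "\<mu>\<^sup>2"] by simp
  qed
  moreover have "sqrt (variance X) = \<mu>" if "a = 1"
    using eq that ab mu by simp
  ultimately show ?thesis by (simp add: \<mu>_def)
qed

end
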